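(* Let $X$ be a variety over $\mathbb F_1$ satisfying the following condition (Z): there exists a polynomial $N(x)\in\mathbb Z[x]$ such that $\#\,\underline{\underline X}(R_n)=N(2n+1)$ for every integer $n\ge1$, where $R_n=\mathbb Z[T]/(T^n-1)$. Let $$Z(q,T)=\exp\Big(\sum_{r\ge1}N(q^r)\,T^r/r\Big).$$ (i) For every $s\in\mathbb R$ the function $Z(q,q^{-s})^{-1}$ has a zero of order $\chi=N(1)$ at $q=1$. Moreover $$\lim_{q\to1}Z(q,q^{-s})^{-1}(q-1)^{-\chi}=\zeta_X(s),$$ where $\zeta_X(s)$ is the value at $s$ of a polynomial with integer coefficients. (ii) If $N(x)=\sum_{i=0}^d a_i\,x^i$, then $$\zeta_X(s)=\prod_{i=0}^d(s-i)^{a_i}.$$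
   Context: $Z(q,T)$ is a formal series in the variables $q$ and $T$; for real $s$ one considers the function $Z(q,q^{-s})$ of $q$ in a neighbourhood of $q=1$. The limit in (i) is the definition of $\zeta_X(s)$. **Varieties over $\mathbb F_1$.** $\mathcal R$ is the category of rings (commutative, unital) finite and flat over $\mathbb Z$; $\mathcal Ens$ is the category of sets. A *gadget over $\mathbb F_1$* is a pair $Y=(\underline Y,a_Y)$ of a covariant functor $\underline Y:\mathcal R\to\mathcal Ens$ and a $\mathbb C$-algebra $a_Y$, with, for every $R\in\mathcal R$, unital ring morphism $\sigma:R\to\mathbb C$ and $y\in\underline Y(R)$, an algebra morphism $e_{y,\sigma}:a_Y\to\mathbb C$, such that $e_{f(y),\sigma}=e_{y,\sigma\circ f}$ for every $f:R'\to R$ in $\mathcal R$, $y\in\underline Y(R')$, $\sigma:R\to\mathbb C$. A morphism $\varphi:Y\to Y'$ of gadgets is a natural transformation $\underline\varphi:\underline Y\to\underline Y'$ with an algebra morphism $\varphi^*:a_{Y'}\to a_Y$ such that $e_{\underline\varphi(y),\sigma}=e_{y,\sigma}\circ\varphi^*$; it is an immersion if $\varphi^*$ and all maps $\underline Y(R)\to\underline Y'(R)$ are injective. A scheme $V$ of finite type over $\mathbb Z$ defines a gadget by $\underline V(R)=\mathrm{Hom}_{\mathbb Z}(\mathrm{Spec}\,R,V)$, the algebra $\mathcal O(V_{\mathbb C})$ of global functions on $V_{\mathbb C}=V\otimes_{\mathbb Z}\mathbb C$, and evaluation at $\sigma(x)\in V(\mathbb C)$. An *affine variety over $\mathbb F_1$*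 is a gadget $A$ with all $\underline A(R)$ finite, for which there are an affine scheme $A_{\mathbb Z}$ of finite type over $\mathbb Z$ and an immersion $i:A\to A_{\mathbb Z}$ of gadgets such that every morphism of gadgets $\varphi:A\to V$ to an affine scheme $V$ of finite type over $\mathbb Z$ is $\varphi_{\mathbb Z}\circ i$ for a unique morphism of schemes $\varphi_{\mathbb Z}:A_{\mathbb Z}\to V$. $\mathcal A$ is the category of affine varieties over $\mathbb F_1$ (full subcategory of gadgets). For $R\in\mathcal R$ the gadget defined by $\mathrm{Spec}(R)$ is an affine variety over $\mathbb F_1$. An *object over $\mathbb F_1$* is a pair $X=(\underline{\underline X},a_X)$ of a contravariant functor $\underline{\underline X}:\mathcal A\to\mathcal Ens$ and a $\mathbb C$-algebra $a_X$, with an algebra morphism $e_x:a_X\to a_A$ for all $A\in\mathcal A$, $x\in\underline{\underline X}(A)$, such that $e_{f^*(x)}=f^*\circ e_x$ for $f:A\to B$ in $\mathcal A$ and $x\in\underline{\underline X}(B)$. Morphisms are pairs of a natural transformation $\underline{\underline\varphi}:\underline{\underline X}\to\underline{\underline Y}$ and an algebra morphism $\varphi^*:a_Y\to a_X$ with $e_{\underline{\underline\varphi}(x)}=e_x\circ\varphi^*$; immersions are those with $\underline{\underline\varphi}$ and $\varphi^*$ injective. A scheme $V$ of finite type over $\mathbb Z$ defines an object with $\underline{\underline V}(A)=\mathrm{Hom}_{\mathbb Z}(A_{\mathbb Z},V)$, algebra $\mathcal O(V_{\mathbb C})$, and $e_x=i^*\circ x^*$. A *variety over $\mathbb F_1$*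 is an object $X$ over $\mathbb F_1$ for which there are a scheme $X_{\mathbb Z}$ of finite type over $\mathbb Z$ and an immersion $i:X\to X_{\mathbb Z}$ of objects such that every morphism of objects $\varphi:X\to V$ to a scheme $V$ of finite type over $\mathbb Z$ is $\varphi_{\mathbb Z}\circ i$ for a unique morphism of schemes $\varphi_{\mathbb Z}:X_{\mathbb Z}\to V$. $\underline{\underline X}(R_n)$ means $\underline{\underline X}(\mathrm{Spec}\,R_n)$; it is viewed as the set of points of $X$ in the degree-$n$ extension $\mathbb F_{1^n}$ of $\mathbb F_1$.
   Formalization: In (i) the order claim is for s not equal to any i with a_i≠0; the limit and (ii) are for s not equal to any i with a_i<0; ζ_X(s) is a quotient of two integer polynomials in general, and a polynomial with integer coefficients when all a_i≥0. *)

theory Defs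
  imports
    "HOL-Complex_Analysis.Complex_Analysis"
    "HOL-Computational_Algebra.Computational_Algebra"
    "HOL-Library.Infinite_Typeclass"
    "HOL-Algebra.QuotRing"
    "HOL-Algebra.Module"
    "HOL-Algebra.Generated_Rings"
    "HOL-Algebra.Generated_Groups"
    "HOL-Algebra.Free_Abelian_Groups"
begin

text \<open>
  Conventions. Morphisms are encoded by extensional functions, so that equality of morphisms is
  equality in HOL. The type variable \<open>'u\<close> plays the role of a universe: rings finite over the
  integers and schemes of finite type over the integers are countable, so for infinite \<open>'u\<close> every
  isomorphism class of them is represented on the types used below.
\<close>

section \<open>Rings, tensor products and algebras\<close>

definition std_ring :: "'a::comm_ring_1 ring" where
  "std_ring = \<lparr>carrier = UNIV, mult = (*), one = 1, ring.zero = 0, add = (+)\<rparr>"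

definition rhom :: "('a, 'm) ring_scheme \<Rightarrow> ('b, 'n) ring_scheme \<Rightarrow> ('a \<Rightarrow> 'b) set" where
  "rhom R S = ring_hom R S \<inter> extensional (carrier R)"

text \<open>The tensor product over the integers of abelian groups \<open>M\<close>, \<open>N\<close> is the free abelian group
  on \<open>carrier M \<times> carrier N\<close> modulo the following subgroup.\<close>

definition tensor_relations ::
  "('a, 'm) monoid_scheme \<Rightarrow> ('b, 'n) monoid_scheme \<Rightarrow> (('a \<times> 'b) \<Rightarrow>\<^sub>0 int) set" where
  "tensor_relations M N = generate (free_Abelian_group (carrier M \<times> carrier N))
     ({frag_of (a \<otimes>\<^bsub>M\<^esub> a', b) - frag_of (a, b) - frag_of (a', b) | a a' b.
         a \<in> carrier M \<and> a' \<in> carrier M \<and> b \<in> carrier N}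
    \<union> {frag_of (a, b \<otimes>\<^bsub>N\<^esub> b') - frag_of (a, b) - frag_of (a, b') | a b b'.
         a \<in> carrier M \<and> b \<in> carrier N \<and> b' \<in> carrier N})"

text \<open>Flatness: tensoring with \<open>M\<close> preserves injectivity of homomorphisms.\<close>

definition flat_over_Z :: "'u monoid \<Rightarrow> bool" where
  "flat_over_Z M \<longleftrightarrow> comm_group M \<and>
     (\<forall>(A :: 'u monoid) (B :: 'u monoid) h.
        comm_group A \<and> comm_group B \<and> h \<in> hom A B \<and> inj_on h (carrier A) \<longrightarrow>
        (\<forall>t \<in> carrier (free_Abelian_group (carrier M \<times> carrier A)).
           frag_extend (\<lambda>(m, a). frag_of (m, h a)) t \<in> tensor_relations M B \<longrightarrow>
           t \<in> tensor_relations M A))"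

definition finite_flat_rings :: "'u ring set" where
  "finite_flat_rings = {R. cring R
     \<and> (\<exists>S. finite S \<and> S \<subseteq> carrier R \<and> generate (add_monoid R) S = carrier R)
     \<and> flat_over_Z (add_monoid R)}"

definition fin_gen_ring :: "('a, 'm) ring_scheme \<Rightarrow> bool" where
  "fin_gen_ring R \<longleftrightarrow> (\<exists>S. finite S \<and> S \<subseteq> carrier R \<and> generate_ring R S = carrier R)"

text \<open>Complex algebras are unital and associative.\<close>

definition complex_algebra :: "(complex, 'a) module \<Rightarrow> bool" where
  "complex_algebra A \<longleftrightarrow> ring A \<and> module (std_ring :: complex ring) A \<and>
     (\<forall>c. \<forall>x \<in> carrier A. \<forall>y \<in> carrier A.
        (c \<odot>\<^bsub>A\<^esub> x) \<otimes>\<^bsub>A\<^esub> y = c \<odot>\<^bsub>A\<^esub> (x \<otimes>\<^bsub>A\<^esub> y) \<and>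
        x \<otimes>\<^bsub>A\<^esub> (c \<odot>\<^bsub>A\<^esub> y) = c \<odot>\<^bsub>A\<^esub> (x \<otimes>\<^bsub>A\<^esub> y))"

definition alg_hom :: "(complex, 'a) module \<Rightarrow> (complex, 'b) module \<Rightarrow> ('a \<Rightarrow> 'b) set" where
  "alg_hom A B = {h \<in> rhom A B. \<forall>c. \<forall>x \<in> carrier A. h (c \<odot>\<^bsub>A\<^esub> x) = c \<odot>\<^bsub>B\<^esub> h x}"

definition complex_alg :: "(complex, complex) module" where
  "complex_alg = \<lparr>carrier = UNIV, mult = (*), one = 1, ring.zero = 0, add = (+), smult = (*)\<rparr>"

text \<open>The integral monoid ring of \<open>B \<times> \<complex>\<close>; dividing it by the tensor relations, which form an
  ideal, gives the ring \<open>B \<otimes> \<complex>\<close>.\<close>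

definition free_ext_ring :: "('s, 'm) ring_scheme \<Rightarrow> (('s \<times> complex) \<Rightarrow>\<^sub>0 int) ring" where
  "free_ext_ring B =
     \<lparr>carrier = {f. Poly_Mapping.keys f \<subseteq> carrier B \<times> UNIV},
      mult = (\<lambda>f g. frag_extend (\<lambda>(b, c). frag_extend (\<lambda>(b', c').
                frag_of (b \<otimes>\<^bsub>B\<^esub> b', c * c')) g) f),
      one = frag_of (\<one>\<^bsub>B\<^esub>, 1), ring.zero = 0, add = (+)\<rparr>"

definition ext_ideal :: "('s, 'm) ring_scheme \<Rightarrow> (('s \<times> complex) \<Rightarrow>\<^sub>0 int) set" where
  "ext_ideal B = tensor_relations (add_monoid B) (add_monoid (std_ring :: complex ring))"

definition complex_ext ::
  "('s, 'm) ring_scheme \<Rightarrow> (complex, (('s \<times> complex) \<Rightarrow>\<^sub>0 int) set) module" where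
  "complex_ext B = (let Q = free_ext_ring B Quot ext_ideal B in
     \<lparr>carrier = carrier Q, mult = mult Q, one = one Q, ring.zero = ring.zero Q, add = add Q,
      smult = (\<lambda>c K. (ext_ideal B +>\<^bsub>free_ext_ring B\<^esub> frag_of (\<one>\<^bsub>B\<^esub>, c)) \<otimes>\<^bsub>Q\<^esub> K)\<rparr>)"

text \<open>The map \<open>h \<otimes> \<complex> : B \<otimes> \<complex> \<rightarrow> B' \<otimes> \<complex>\<close> (first argument: the target ring), and the map
  \<open>B \<otimes> \<complex> \<rightarrow> \<complex>\<close>, \<open>b \<otimes> c \<mapsto> u(b) c\<close>.\<close>

definition complex_ext_map ::
  "('t, 'n) ring_scheme \<Rightarrow> ('s \<Rightarrow> 't) \<Rightarrow> (('s \<times> complex) \<Rightarrow>\<^sub>0 int) set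
     \<Rightarrow> (('t \<times> complex) \<Rightarrow>\<^sub>0 int) set" where
  "complex_ext_map B' h K =
     (\<Union>t \<in> K. ext_ideal B' +>\<^bsub>free_ext_ring B'\<^esub> frag_extend (\<lambda>(b, c). frag_of (h b, c)) t)"

definition complex_ext_eval :: "('s \<Rightarrow> complex) \<Rightarrow> (('s \<times> complex) \<Rightarrow>\<^sub>0 int) set \<Rightarrow> complex" where
  "complex_ext_eval u K = (THE z. \<exists>t \<in> K.
     z = (\<Sum>x \<in> Poly_Mapping.keys t. of_int (Poly_Mapping.lookup t x) * (u (fst x) * snd x)))"

section \<open>Locally ringed spaces\<close>

text \<open>\<open>sec X U\<close> and \<open>rst X U V\<close> are relevant only for open \<open>U\<close> and \<open>V \<subseteq> U\<close>.\<close>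

record ('p, 's) ringed_space =
  spc :: "'p topology"
  sec :: "'p set \<Rightarrow> 's ring"
  rst :: "'p set \<Rightarrow> 'p set \<Rightarrow> 's \<Rightarrow> 's"

definition ringed_space :: "('p, 's) ringed_space \<Rightarrow> bool" where
  "ringed_space X \<longleftrightarrow>
     (\<forall>U. openin (spc X) U \<longrightarrow> cring (sec X U)) \<and>
     (\<forall>U V. openin (spc X) U \<and> openin (spc X) V \<and> V \<subseteq> U \<longrightarrow>
        rst X U V \<in> ring_hom (sec X U) (sec X V)) \<and>
     (\<forall>U. openin (spc X) U \<longrightarrow> (\<forall>s \<in> carrier (sec X U). rst X U U s = s)) \<and>
     (\<forall>U V W. openin (spc X) U \<and> openin (spc X) V \<and> openin (spc X) W \<and> W \<subseteq> V \<and> V \<subseteq> U \<longrightarrow>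
        (\<forall>s \<in> carrier (sec X U). rst X V W (rst X U V s) = rst X U W s)) \<and>
     (\<forall>\<V>. (\<forall>V \<in> \<V>. openin (spc X) V) \<longrightarrow>
        (\<forall>s \<in> carrier (sec X (\<Union>\<V>)). \<forall>t \<in> carrier (sec X (\<Union>\<V>)).
           (\<forall>V \<in> \<V>. rst X (\<Union>\<V>) V s = rst X (\<Union>\<V>) V t) \<longrightarrow> s = t) \<and>
        (\<forall>f. (\<forall>V \<in> \<V>. f V \<in> carrier (sec X V)) \<and>
             (\<forall>V \<in> \<V>. \<forall>W \<in> \<V>. rst X V (V \<inter> W) (f V) = rst X W (V \<inter> W) (f W)) \<longrightarrow>
           (\<exists>s \<in> carrier (sec X (\<Union>\<V>)). \<forall>V \<in> \<V>. rst X (\<Union>\<V>) V s = f V)))"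

definition germ :: "('p, 's) ringed_space \<Rightarrow> 'p \<Rightarrow> 'p set \<Rightarrow> 's \<Rightarrow> ('p set \<times> 's) set" where
  "germ X p U s = {(V, t). openin (spc X) V \<and> p \<in> V \<and> t \<in> carrier (sec X V) \<and>
     (\<exists>W. openin (spc X) W \<and> p \<in> W \<and> W \<subseteq> U \<inter> V \<and> rst X U W s = rst X V W t)}"

definition stalk :: "('p, 's) ringed_space \<Rightarrow> 'p \<Rightarrow> ('p set \<times> 's) set ring" where
  "stalk X p =
     \<lparr>carrier = {germ X p U s | U s. openin (spc X) U \<and> p \<in> U \<and> s \<in> carrier (sec X U)},
      mult = (\<lambda>a b. THE c. \<exists>U. openin (spc X) U \<and> p \<in> U \<and>
        (\<exists>s \<in> carrier (sec X U). \<exists>t \<in> carrier (sec X U).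
           a = germ X p U s \<and> b = germ X p U t \<and> c = germ X p U (s \<otimes>\<^bsub>sec X U\<^esub> t))),
      one = germ X p (topspace (spc X)) \<one>\<^bsub>sec X (topspace (spc X))\<^esub>,
      ring.zero = germ X p (topspace (spc X)) \<zero>\<^bsub>sec X (topspace (spc X))\<^esub>,
      add = (\<lambda>a b. THE c. \<exists>U. openin (spc X) U \<and> p \<in> U \<and>
        (\<exists>s \<in> carrier (sec X U). \<exists>t \<in> carrier (sec X U).
           a = germ X p U s \<and> b = germ X p U t \<and> c = germ X p U (s \<oplus>\<^bsub>sec X U\<^esub> t)))\<rparr>"

definition local_ring :: "('a, 'm) ring_scheme \<Rightarrow> bool" where
  "local_ring R \<longleftrightarrow> cring R \<and> (\<exists>!M. maximalideal M R)"

definition locally_ringed_space :: "('p, 's) ringed_space \<Rightarrow> bool" where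
  "locally_ringed_space X \<longleftrightarrow>
     ringed_space X \<and> (\<forall>p \<in> topspace (spc X). local_ring (stalk X p))"

definition pre :: "('p, 's) ringed_space \<Rightarrow> ('p \<Rightarrow> 'q) \<Rightarrow> 'q set \<Rightarrow> 'p set" where
  "pre X f V = {p \<in> topspace (spc X). f p \<in> V}"

type_synonym ('p, 's, 'q, 't) mor = "('p \<Rightarrow> 'q) \<times> ('q set \<Rightarrow> 't \<Rightarrow> 's)"

text \<open>Morphisms of locally ringed spaces; the last clause says that the induced maps on stalks
  send the maximal ideal into the maximal ideal.\<close>

definition mor ::
  "('p, 's) ringed_space \<Rightarrow> ('q, 't) ringed_space \<Rightarrow> ('p, 's, 'q, 't) mor set" where
  "mor X Y = {(f, h).
     continuous_map (spc X) (spc Y) f \<and> f \<in> extensional (topspace (spc X)) \<and>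
     h \<in> extensional {V. openin (spc Y) V} \<and>
     (\<forall>V. openin (spc Y) V \<longrightarrow> h V \<in> rhom (sec Y V) (sec X (pre X f V))) \<and>
     (\<forall>V W. openin (spc Y) V \<and> openin (spc Y) W \<and> W \<subseteq> V \<longrightarrow>
        (\<forall>s \<in> carrier (sec Y V).
           h W (rst Y V W s) = rst X (pre X f V) (pre X f W) (h V s))) \<and>
     (\<forall>p \<in> topspace (spc X). \<forall>M M'. maximalideal M (stalk X p) \<and> maximalideal M' (stalk Y (f p)) \<longrightarrow>
        (\<forall>V s. openin (spc Y) V \<and> f p \<in> V \<and> s \<in> carrier (sec Y V) \<and> germ Y (f p) V s \<in> M' \<longrightarrow>
           germ X p (pre X f V) (h V s) \<in> M))}"

definition mor_id :: "('p, 's) ringed_space \<Rightarrow> ('p, 's, 'p, 's) mor" where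
  "mor_id X = (\<lambda>p \<in> topspace (spc X). p, \<lambda>U \<in> {U. openin (spc X) U}. \<lambda>s \<in> carrier (sec X U). s)"

text \<open>\<open>mor_comp X Y Z g f\<close> is the composite of \<open>f : X \<rightarrow> Y\<close> with \<open>g : Y \<rightarrow> Z\<close>.\<close>

definition mor_comp ::
  "('p, 's) ringed_space \<Rightarrow> ('q, 't) ringed_space \<Rightarrow> ('r, 'v) ringed_space \<Rightarrow>
   ('q, 't, 'r, 'v) mor \<Rightarrow> ('p, 's, 'q, 't) mor \<Rightarrow> ('p, 's, 'r, 'v) mor" where
  "mor_comp X Y Z g f =
     (\<lambda>p \<in> topspace (spc X). fst g (fst f p),
      \<lambda>W \<in> {W. openin (spc Z) W}. \<lambda>s \<in> carrier (sec Z W). snd f (pre Y (fst g) W) (snd g W s))"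

definition isomorphic_spaces ::
  "('p, 's) ringed_space \<Rightarrow> ('q, 't) ringed_space \<Rightarrow> bool" where
  "isomorphic_spaces X Y \<longleftrightarrow> (\<exists>f \<in> mor X Y. \<exists>g \<in> mor Y X.
     mor_comp X Y X g f = mor_id X \<and> mor_comp Y X Y f g = mor_id Y)"

definition open_subspace :: "('p, 's) ringed_space \<Rightarrow> 'p set \<Rightarrow> ('p, 's) ringed_space" where
  "open_subspace X U = X\<lparr>spc := subtopology (spc X) U\<rparr>"

section \<open>Spectra and schemes of finite type over the integers\<close>

definition primes :: "'a ring \<Rightarrow> 'a set set" where
  "primes R = {P. primeideal P R}"

definition loc_frac :: "'a ring \<Rightarrow> 'a set \<Rightarrow> 'a \<Rightarrow> 'a \<Rightarrow> ('a \<times> 'a) set" where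
  "loc_frac R P a s = {(b, t). b \<in> carrier R \<and> t \<in> carrier R - P \<and>
     (\<exists>u \<in> carrier R - P. u \<otimes>\<^bsub>R\<^esub> (a \<otimes>\<^bsub>R\<^esub> t) = u \<otimes>\<^bsub>R\<^esub> (b \<otimes>\<^bsub>R\<^esub> s))}"

definition localization :: "'a ring \<Rightarrow> 'a set \<Rightarrow> ('a \<times> 'a) set ring" where
  "localization R P =
     \<lparr>carrier = {loc_frac R P a s | a s. a \<in> carrier R \<and> s \<in> carrier R - P},
      mult = (\<lambda>x y. THE z. \<exists>a \<in> carrier R. \<exists>s \<in> carrier R - P. \<exists>b \<in> carrier R. \<exists>t \<in> carrier R - P.
        x = loc_frac R P a s \<and> y = loc_frac R P b t \<and> z = loc_frac R P (a \<otimes>\<^bsub>R\<^esub> b) (s \<otimes>\<^bsub>R\<^esub> t)),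
      one = loc_frac R P \<one>\<^bsub>R\<^esub> \<one>\<^bsub>R\<^esub>,
      ring.zero = loc_frac R P \<zero>\<^bsub>R\<^esub> \<one>\<^bsub>R\<^esub>,
      add = (\<lambda>x y. THE z. \<exists>a \<in> carrier R. \<exists>s \<in> carrier R - P. \<exists>b \<in> carrier R. \<exists>t \<in> carrier R - P.
        x = loc_frac R P a s \<and> y = loc_frac R P b t \<and>
        z = loc_frac R P (a \<otimes>\<^bsub>R\<^esub> t \<oplus>\<^bsub>R\<^esub> b \<otimes>\<^bsub>R\<^esub> s) (s \<otimes>\<^bsub>R\<^esub> t))\<rparr>"

type_synonym 'a spec_sec = "'a set \<Rightarrow> ('a \<times> 'a) set"

definition zariski_topology :: "'a ring \<Rightarrow> 'a set topology" where
  "zariski_topology R = topology_generated_by {{P \<in> primes R. a \<notin> P} | a. a \<in> carrier R}"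

text \<open>The structure sheaf consists of functions with values in the localizations that are locally
  given by a single fraction.\<close>

definition Spec :: "'a ring \<Rightarrow> ('a set, 'a spec_sec) ringed_space" where
  "Spec R =
     \<lparr>spc = zariski_topology R,
      sec = (\<lambda>U.
        \<lparr>carrier = {s \<in> extensional U. \<forall>P \<in> U. \<exists>V. openin (zariski_topology R) V \<and> P \<in> V \<and> V \<subseteq> U \<and>
            (\<exists>a \<in> carrier R. \<exists>t \<in> carrier R. \<forall>Q \<in> V. t \<notin> Q \<and> s Q = loc_frac R Q a t)},
         mult = (\<lambda>s t. \<lambda>P \<in> U. s P \<otimes>\<^bsub>localization R P\<^esub> t P),
         one = (\<lambda>P \<in> U. \<one>\<^bsub>localization R P\<^esub>),
         ring.zero = (\<lambda>P \<in> U. \<zero>\<^bsub>localization R P\<^esub>),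
         add = (\<lambda>s t. \<lambda>P \<in> U. s P \<oplus>\<^bsub>localization R P\<^esub> t P)\<rparr>),
      rst = (\<lambda>U V s. restrict s V)\<rparr>"

text \<open>The morphism \<open>Spec S \<rightarrow> Spec R\<close> defined by \<open>f : R \<rightarrow> S\<close>.\<close>

definition Spec_map ::
  "'a ring \<Rightarrow> 'b ring \<Rightarrow> ('a \<Rightarrow> 'b) \<Rightarrow> ('b set, 'b spec_sec, 'a set, 'a spec_sec) mor" where
  "Spec_map R S f =
     (let c = (\<lambda>P \<in> primes S. {a \<in> carrier R. f a \<in> P}) in
      (c, \<lambda>U \<in> {U. openin (zariski_topology R) U}. \<lambda>s \<in> carrier (sec (Spec R) U).
            \<lambda>P \<in> pre (Spec S) c U. THE y. \<exists>(a, t) \<in> s (c P). y = loc_frac S P (f a) (f t)))"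

text \<open>For a space isomorphic to \<open>Spec B\<close> the ring \<open>B\<close> is isomorphic to the ring of global
  sections; hence it can be sought on the type of sections.\<close>

definition is_affine :: "('p, 's) ringed_space \<Rightarrow> bool" where
  "is_affine X \<longleftrightarrow> (\<exists>B :: 's ring. cring B \<and> isomorphic_spaces X (Spec B))"

definition affine_opens :: "('p, 's) ringed_space \<Rightarrow> 'p set set" where
  "affine_opens X = {U. openin (spc X) U \<and> is_affine (open_subspace X U)}"

definition scheme :: "('p, 's) ringed_space \<Rightarrow> bool" where
  "scheme X \<longleftrightarrow> locally_ringed_space X \<and> \<Union>(affine_opens X) = topspace (spc X)"

definition finite_type_scheme :: "('p, 's) ringed_space \<Rightarrow> bool" where
  "finite_type_scheme X \<longleftrightarrow> scheme X \<and>
     (\<exists>\<U>. finite \<U> \<and> \<U> \<subseteq> affine_opens X \<and> \<Union>\<U> = topspace (spc X) \<and>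
        (\<forall>U \<in> \<U>. fin_gen_ring (sec X U)))"

section \<open>Functions on the complexification of a scheme\<close>

text \<open>\<open>V\<^sub>\<complex>\<close> is glued from the spectra of \<open>O(U) \<otimes> \<complex>\<close>, \<open>U\<close> ranging over the affine opens of \<open>V\<close>.
  A global function on \<open>V\<^sub>\<complex>\<close> is therefore a compatible family of elements of these algebras.\<close>

type_synonym ('p, 's) cfun = "'p set \<Rightarrow> (('s \<times> complex) \<Rightarrow>\<^sub>0 int) set"

definition complex_functions :: "('p, 's) ringed_space \<Rightarrow> (complex, ('p, 's) cfun) module" where
  "complex_functions V =
     \<lparr>carrier = {F \<in> (\<Pi>\<^sub>E U \<in> affine_opens V. carrier (complex_ext (sec V U))).
        \<forall>U \<in> affine_opens V. \<forall>W \<in> affine_opens V. W \<subseteq> U \<longrightarrow>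
          complex_ext_map (sec V W) (rst V U W) (F U) = F W},
      mult = (\<lambda>F G. \<lambda>U \<in> affine_opens V. F U \<otimes>\<^bsub>complex_ext (sec V U)\<^esub> G U),
      one = (\<lambda>U \<in> affine_opens V. \<one>\<^bsub>complex_ext (sec V U)\<^esub>),
      ring.zero = (\<lambda>U \<in> affine_opens V. \<zero>\<^bsub>complex_ext (sec V U)\<^esub>),
      add = (\<lambda>F G. \<lambda>U \<in> affine_opens V. F U \<oplus>\<^bsub>complex_ext (sec V U)\<^esub> G U),
      smult = (\<lambda>c F. \<lambda>U \<in> affine_opens V. c \<odot>\<^bsub>complex_ext (sec V U)\<^esub> F U)\<rparr>"

text \<open>Pullback of functions along \<open>x : W \<rightarrow> V\<close>. It is determined on the affine opens of \<open>W\<close> that are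
  mapped into some affine open of \<open>V\<close>, since these cover \<open>W\<close>.\<close>

definition pullback ::
  "('p, 's) ringed_space \<Rightarrow> ('q, 't) ringed_space \<Rightarrow> ('p, 's, 'q, 't) mor \<Rightarrow>
   ('q, 't) cfun \<Rightarrow> ('p, 's) cfun" where
  "pullback W V x = (\<lambda>F \<in> carrier (complex_functions V).
     THE G. G \<in> carrier (complex_functions W) \<and>
       (\<forall>U \<in> affine_opens V. \<forall>U' \<in> affine_opens W. U' \<subseteq> pre W (fst x) U \<longrightarrow>
          G U' = complex_ext_map (sec W U') (rst W (pre W (fst x) U) U' \<circ> snd x U) (F U)))"

text \<open>Evaluation of functions on \<open>V\<^sub>\<complex>\<close> at the complex point \<open>Spec \<complex> \<rightarrow> Spec R \<rightarrow> V\<close>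
  defined by \<open>\<sigma> : R \<rightarrow> \<complex>\<close> and \<open>x : Spec R \<rightarrow> V\<close>. The image of the point of \<open>Spec \<complex>\<close> in
  \<open>Spec R\<close> is the kernel of \<open>\<sigma>\<close>.\<close>

definition eval_at ::
  "'u ring \<Rightarrow> ('q, 't) ringed_space \<Rightarrow> ('u set, 'u spec_sec, 'q, 't) mor \<Rightarrow> ('u \<Rightarrow> complex) \<Rightarrow>
   ('q, 't) cfun \<Rightarrow> complex" where
  "eval_at R V x \<sigma> =
     (let P = a_kernel R (std_ring :: complex ring) \<sigma> in
      (\<lambda>F \<in> carrier (complex_functions V). THE z. \<forall>U \<in> affine_opens V. fst x P \<in> U \<longrightarrow>
        z = complex_ext_eval (\<lambda>g. THE w. \<exists>(a, t) \<in> snd x U g P. w = \<sigma> a / \<sigma> t) (F U)))"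

section \<open>Gadgets and affine varieties over the field with one element\<close>

record ('u, 'y, 'a) gadget =
  gpts :: "'u ring \<Rightarrow> 'y set"
  gmap :: "'u ring \<Rightarrow> 'u ring \<Rightarrow> ('u \<Rightarrow> 'u) \<Rightarrow> 'y \<Rightarrow> 'y"
  galg :: "(complex, 'a) module"
  gev :: "'u ring \<Rightarrow> 'y \<Rightarrow> ('u \<Rightarrow> complex) \<Rightarrow> 'a \<Rightarrow> complex"

definition is_gadget :: "('u, 'y, 'a) gadget \<Rightarrow> bool" where
  "is_gadget Y \<longleftrightarrow>
     (\<forall>R \<in> finite_flat_rings. \<forall>S \<in> finite_flat_rings. \<forall>f \<in> rhom R S. \<forall>y \<in> gpts Y R.
        gmap Y R S f y \<in> gpts Y S) \<and>
     (\<forall>R \<in> finite_flat_rings. \<forall>y \<in> gpts Y R. gmap Y R R (\<lambda>a \<in> carrier R. a) y = y) \<and>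
     (\<forall>R \<in> finite_flat_rings. \<forall>S \<in> finite_flat_rings. \<forall>T \<in> finite_flat_rings.
        \<forall>f \<in> rhom R S. \<forall>g \<in> rhom S T. \<forall>y \<in> gpts Y R.
        gmap Y R T (compose (carrier R) g f) y = gmap Y S T g (gmap Y R S f y)) \<and>
     complex_algebra (galg Y) \<and>
     (\<forall>R \<in> finite_flat_rings. \<forall>y \<in> gpts Y R. \<forall>\<sigma> \<in> rhom R std_ring.
        gev Y R y \<sigma> \<in> alg_hom (galg Y) complex_alg) \<and>
     (\<forall>R \<in> finite_flat_rings. \<forall>S \<in> finite_flat_rings. \<forall>f \<in> rhom R S. \<forall>y \<in> gpts Y R.
        \<forall>\<sigma> \<in> rhom S std_ring. gev Y S (gmap Y R S f y) \<sigma> = gev Y R y (compose (carrier R) \<sigma> f))"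

type_synonym ('u, 'y, 'a, 'z, 'b) gmor = "('u ring \<Rightarrow> 'y \<Rightarrow> 'z) \<times> ('b \<Rightarrow> 'a)"

definition gadget_hom ::
  "('u, 'y, 'a) gadget \<Rightarrow> ('u, 'z, 'b) gadget \<Rightarrow> ('u, 'y, 'a, 'z, 'b) gmor set" where
  "gadget_hom Y Z = {(\<phi>, \<psi>).
     \<phi> \<in> (\<Pi>\<^sub>E R \<in> finite_flat_rings. gpts Y R \<rightarrow>\<^sub>E gpts Z R) \<and>
     (\<forall>R \<in> finite_flat_rings. \<forall>S \<in> finite_flat_rings. \<forall>f \<in> rhom R S. \<forall>y \<in> gpts Y R.
        \<phi> S (gmap Y R S f y) = gmap Z R S f (\<phi> R y)) \<and>
     \<psi> \<in> alg_hom (galg Z) (galg Y) \<and>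
     (\<forall>R \<in> finite_flat_rings. \<forall>y \<in> gpts Y R. \<forall>\<sigma> \<in> rhom R std_ring.
        gev Z R (\<phi> R y) \<sigma> = compose (carrier (galg Z)) (gev Y R y \<sigma>) \<psi>)}"

definition gadget_immersion ::
  "('u, 'y, 'a) gadget \<Rightarrow> ('u, 'z, 'b) gadget \<Rightarrow> ('u, 'y, 'a, 'z, 'b) gmor \<Rightarrow> bool" where
  "gadget_immersion Y Z i \<longleftrightarrow> i \<in> gadget_hom Y Z \<and> inj_on (snd i) (carrier (galg Z)) \<and>
     (\<forall>R \<in> finite_flat_rings. inj_on (fst i R) (gpts Y R))"

definition gadget_id :: "('u, 'y, 'a) gadget \<Rightarrow> ('u, 'y, 'a, 'y, 'a) gmor" where
  "gadget_id Y = (\<lambda>R \<in> finite_flat_rings. \<lambda>y \<in> gpts Y R. y, \<lambda>a \<in> carrier (galg Y). a)"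

text \<open>\<open>gadget_comp Y W g f\<close> is the composite of \<open>f : Y \<rightarrow> Z\<close> with \<open>g : Z \<rightarrow> W\<close>.\<close>

definition gadget_comp ::
  "('u, 'y, 'a) gadget \<Rightarrow> ('u, 'w, 'c) gadget \<Rightarrow>
   ('u, 'z, 'b, 'w, 'c) gmor \<Rightarrow> ('u, 'y, 'a, 'z, 'b) gmor \<Rightarrow> ('u, 'y, 'a, 'w, 'c) gmor" where
  "gadget_comp Y W g f =
     (\<lambda>R \<in> finite_flat_rings. compose (gpts Y R) (fst g R) (fst f R),
      compose (carrier (galg W)) (snd f) (snd g))"

definition scheme_gadget ::
  "('q, 't) ringed_space \<Rightarrow> ('u, ('u set, 'u spec_sec, 'q, 't) mor, ('q, 't) cfun) gadget" where
  "scheme_gadget V =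
     \<lparr>gpts = (\<lambda>R. mor (Spec R) V),
      gmap = (\<lambda>R S f x. mor_comp (Spec S) (Spec R) V x (Spec_map R S f)),
      galg = complex_functions V,
      gev = (\<lambda>R x \<sigma>. eval_at R V x \<sigma>)\<rparr>"

text \<open>From here on everything lives in the universe given by \<open>'u\<close>.\<close>

type_synonym 'u univ_scheme = "('u set, 'u spec_sec) ringed_space"
type_synonym 'u univ_mor = "('u set, 'u spec_sec, 'u set, 'u spec_sec) mor"
type_synonym 'u univ_alg = "('u set, 'u spec_sec) cfun"
type_synonym 'u univ_gadget = "('u, 'u univ_mor, 'u univ_alg) gadget"
type_synonym 'u univ_gmor = "('u, 'u univ_mor, 'u univ_alg, 'u univ_mor, 'u univ_alg) gmor"

definition scheme_gadget_mor ::
  "'u univ_scheme \<Rightarrow> 'u univ_scheme \<Rightarrow> 'u univ_mor \<Rightarrow> 'u univ_gmor" where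
  "scheme_gadget_mor V W \<phi> =
     (\<lambda>R \<in> finite_flat_rings. \<lambda>x \<in> mor (Spec R) V. mor_comp (Spec R) V W \<phi> x, pullback V W \<phi>)"

text \<open>\<open>(AZ, i)\<close> is an affine scheme of finite type with an immersion of \<open>A\<close> that is universal for
  morphisms from \<open>A\<close> to affine schemes of finite type.\<close>

definition affine_model :: "'u univ_gadget \<Rightarrow> 'u univ_scheme \<Rightarrow> 'u univ_gmor \<Rightarrow> bool" where
  "affine_model A AZ i \<longleftrightarrow>
     finite_type_scheme AZ \<and> is_affine AZ \<and> gadget_immersion A (scheme_gadget AZ) i \<and>
     (\<forall>V :: 'u univ_scheme. finite_type_scheme V \<and> is_affine V \<longrightarrow>
        (\<forall>\<phi> \<in> gadget_hom A (scheme_gadget V). \<exists>!\<phi>Z. \<phi>Z \<in> mor AZ V \<and>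
           \<phi> = gadget_comp A (scheme_gadget V) (scheme_gadget_mor AZ V \<phi>Z) i))"

definition affine_f1_varieties :: "'u univ_gadget set" where
  "affine_f1_varieties = {A. is_gadget A \<and> (\<forall>R \<in> finite_flat_rings. finite (gpts A R)) \<and>
     (\<exists>AZ i. affine_model A AZ i)}"

text \<open>A choice of the pair \<open>(AZ, i)\<close>, which is unique up to unique isomorphism, and the morphism
  \<open>AZ \<rightarrow> BZ\<close> induced by \<open>f : A \<rightarrow> B\<close>.\<close>

definition model :: "'u univ_gadget \<Rightarrow> 'u univ_scheme \<times> 'u univ_gmor" where
  "model A = (SOME m. affine_model A (fst m) (snd m))"

definition model_scheme :: "'u univ_gadget \<Rightarrow> 'u univ_scheme" where
  "model_scheme A = fst (model A)"

definition model_immersion :: "'u univ_gadget \<Rightarrow> 'u univ_gmor" where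
  "model_immersion A = snd (model A)"

definition model_map :: "'u univ_gadget \<Rightarrow> 'u univ_gadget \<Rightarrow> 'u univ_gmor \<Rightarrow> 'u univ_mor" where
  "model_map A B f = (THE g. g \<in> mor (model_scheme A) (model_scheme B) \<and>
     gadget_comp A (scheme_gadget (model_scheme B)) (model_immersion B) f =
     gadget_comp A (scheme_gadget (model_scheme B))
       (scheme_gadget_mor (model_scheme A) (model_scheme B) g) (model_immersion A))"

section \<open>Objects and varieties over the field with one element\<close>

text \<open>For \<open>f : A \<rightarrow> B\<close>, \<open>omap X A B f\<close> is the map \<open>f\<^sup>* : X(B) \<rightarrow> X(A)\<close>.\<close>

record ('u, 'x, 'b) f1_object =
  opts :: "'u univ_gadget \<Rightarrow> 'x set"
  omap :: "'u univ_gadget \<Rightarrow> 'u univ_gadget \<Rightarrow> 'u univ_gmor \<Rightarrow> 'x \<Rightarrow> 'x"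
  oalg :: "(complex, 'b) module"
  oev :: "'u univ_gadget \<Rightarrow> 'x \<Rightarrow> 'b \<Rightarrow> 'u univ_alg"

definition is_f1_object :: "('u, 'x, 'b) f1_object \<Rightarrow> bool" where
  "is_f1_object X \<longleftrightarrow>
     (\<forall>A \<in> affine_f1_varieties. \<forall>B \<in> affine_f1_varieties. \<forall>f \<in> gadget_hom A B. \<forall>x \<in> opts X B.
        omap X A B f x \<in> opts X A) \<and>
     (\<forall>A \<in> affine_f1_varieties. \<forall>x \<in> opts X A. omap X A A (gadget_id A) x = x) \<and>
     (\<forall>A \<in> affine_f1_varieties. \<forall>B \<in> affine_f1_varieties. \<forall>C \<in> affine_f1_varieties.
        \<forall>f \<in> gadget_hom A B. \<forall>g \<in> gadget_hom B C. \<forall>x \<in> opts X C.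
        omap X A C (gadget_comp A C g f) x = omap X A B f (omap X B C g x)) \<and>
     complex_algebra (oalg X) \<and>
     (\<forall>A \<in> affine_f1_varieties. \<forall>x \<in> opts X A. oev X A x \<in> alg_hom (oalg X) (galg A)) \<and>
     (\<forall>A \<in> affine_f1_varieties. \<forall>B \<in> affine_f1_varieties. \<forall>f \<in> gadget_hom A B. \<forall>x \<in> opts X B.
        oev X A (omap X A B f x) = compose (carrier (oalg X)) (snd f) (oev X B x))"

type_synonym ('u, 'x, 'b, 'y, 'c) omor = "('u univ_gadget \<Rightarrow> 'x \<Rightarrow> 'y) \<times> ('c \<Rightarrow> 'b)"

definition object_hom ::
  "('u, 'x, 'b) f1_object \<Rightarrow> ('u, 'y, 'c) f1_object \<Rightarrow> ('u, 'x, 'b, 'y, 'c) omor set" where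
  "object_hom X Y = {(\<phi>, \<psi>).
     \<phi> \<in> (\<Pi>\<^sub>E A \<in> affine_f1_varieties. opts X A \<rightarrow>\<^sub>E opts Y A) \<and>
     (\<forall>A \<in> affine_f1_varieties. \<forall>B \<in> affine_f1_varieties. \<forall>f \<in> gadget_hom A B. \<forall>x \<in> opts X B.
        \<phi> A (omap X A B f x) = omap Y A B f (\<phi> B x)) \<and>
     \<psi> \<in> alg_hom (oalg Y) (oalg X) \<and>
     (\<forall>A \<in> affine_f1_varieties. \<forall>x \<in> opts X A.
        oev Y A (\<phi> A x) = compose (carrier (oalg Y)) (oev X A x) \<psi>)}"

definition object_immersion ::
  "('u, 'x, 'b) f1_object \<Rightarrow> ('u, 'y, 'c) f1_object \<Rightarrow> ('u, 'x, 'b, 'y, 'c) omor \<Rightarrow> bool" where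
  "object_immersion X Y i \<longleftrightarrow> i \<in> object_hom X Y \<and> inj_on (snd i) (carrier (oalg Y)) \<and>
     (\<forall>A \<in> affine_f1_varieties. inj_on (fst i A) (opts X A))"

definition object_comp ::
  "('u, 'x, 'b) f1_object \<Rightarrow> ('u, 'z, 'd) f1_object \<Rightarrow>
   ('u, 'y, 'c, 'z, 'd) omor \<Rightarrow> ('u, 'x, 'b, 'y, 'c) omor \<Rightarrow> ('u, 'x, 'b, 'z, 'd) omor" where
  "object_comp X Z g f =
     (\<lambda>A \<in> affine_f1_varieties. compose (opts X A) (fst g A) (fst f A),
      compose (carrier (oalg Z)) (snd f) (snd g))"

definition scheme_object :: "'u univ_scheme \<Rightarrow> ('u, 'u univ_mor, 'u univ_alg) f1_object" where
  "scheme_object V =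
     \<lparr>opts = (\<lambda>A. mor (model_scheme A) V),
      omap = (\<lambda>A B f x. mor_comp (model_scheme A) (model_scheme B) V x (model_map A B f)),
      oalg = complex_functions V,
      oev = (\<lambda>A x. compose (carrier (complex_functions V))
                     (snd (model_immersion A)) (pullback (model_scheme A) V x))\<rparr>"

definition scheme_object_mor ::
  "'u univ_scheme \<Rightarrow> 'u univ_scheme \<Rightarrow> 'u univ_mor \<Rightarrow>
   ('u, 'u univ_mor, 'u univ_alg, 'u univ_mor, 'u univ_alg) omor" where
  "scheme_object_mor V W \<phi> =
     (\<lambda>A \<in> affine_f1_varieties. \<lambda>x \<in> mor (model_scheme A) V. mor_comp (model_scheme A) V W \<phi> x,
      pullback V W \<phi>)"

definition f1_variety :: "('u, 'x, 'b) f1_object \<Rightarrow> bool" where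
  "f1_variety X \<longleftrightarrow> is_f1_object X \<and>
     (\<exists>(XZ :: 'u univ_scheme) i. finite_type_scheme XZ \<and>
        object_immersion X (scheme_object XZ) i \<and>
        (\<forall>V :: 'u univ_scheme. finite_type_scheme V \<longrightarrow>
           (\<forall>\<phi> \<in> object_hom X (scheme_object V). \<exists>!\<phi>Z. \<phi>Z \<in> mor XZ V \<and>
              \<phi> = object_comp X (scheme_object V) (scheme_object_mor XZ V \<phi>Z) i)))"

section \<open>Point counts and the zeta function\<close>

definition R_ring :: "nat \<Rightarrow> int poly set ring" where
  "R_ring n = std_ring Quot (PIdl\<^bsub>std_ring\<^esub> (Polynomial.monom 1 n - 1))"

text \<open>\<open>R_ring n\<close> has its own carrier type, so copies \<open>R\<close> of it in the universe are used; all
  of them give the same number of points.\<close>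

definition point_count_polynomial :: "('u, 'x, 'b) f1_object \<Rightarrow> int poly \<Rightarrow> bool" where
  "point_count_polynomial X N \<longleftrightarrow>
     (\<forall>n \<ge> 1. \<forall>R \<in> finite_flat_rings. R \<simeq> R_ring n \<longrightarrow>
        finite (opts X (scheme_gadget (Spec R))) \<and>
        int (card (opts X (scheme_gadget (Spec R)))) = poly N (2 * int n + 1))"

text \<open>The formal series \<open>Z(q, T)\<close>: a power series in \<open>T\<close> whose coefficients are polynomials in \<open>q\<close>.
  The power series \<open>exp\<close> is composed with \<open>\<Sum>r\<ge>1. N(q ^ r) T ^ r / r\<close>.\<close>

definition zeta_series :: "int poly \<Rightarrow> complex poly fps" where
  "zeta_series N =
     Abs_fps (\<lambda>k. [:1 / fact k:]) oo
     Abs_fps (\<lambda>r. if r = 0 then 0 else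
       Polynomial.smult (1 / of_nat r) (pcompose (map_poly of_int N) (Polynomial.monom 1 r)))"

definition specialize_fps :: "'a::comm_ring_1 poly fps \<Rightarrow> 'a \<Rightarrow> 'a fps" where
  "specialize_fps F q = Abs_fps (\<lambda>k. poly (fps_nth F k) q)"

text \<open>The value at \<open>t\<close> of the rational function with Taylor expansion \<open>F\<close> at \<open>0\<close>. The point \<open>t\<close>
  need not lie in the disc of convergence of \<open>F\<close>.\<close>

definition rational_value :: "complex fps \<Rightarrow> complex \<Rightarrow> complex" where
  "rational_value F t = (THE v. \<exists>P Q. Q \<noteq> 0 \<and> coprime P Q \<and>
     F * fps_of_poly Q = fps_of_poly P \<and> v = poly P t / poly Q t)"

text \<open>\<open>Z(q, q\<^sup>-\<^sup>s)\<^sup>-\<^sup>1\<close>, with the principal branch of the power near \<open>q = 1\<close>. Where \<open>Z\<close> has a pole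
  the convention \<open>inverse 0 = 0\<close> yields the value \<open>0\<close> of its reciprocal.\<close>

definition inv_Z :: "int poly \<Rightarrow> real \<Rightarrow> complex \<Rightarrow> complex" where
  "inv_Z N s q =
     inverse (rational_value (specialize_fps (zeta_series N) q) (q powr (- complex_of_real s)))"

text \<open>A zero of negative order \<open>n\<close> is a pole of order \<open>- n\<close>.\<close>

definition has_zero_of_order :: "(complex \<Rightarrow> complex) \<Rightarrow> complex \<Rightarrow> int \<Rightarrow> bool" where
  "has_zero_of_order f z n \<longleftrightarrow>
     f meromorphic_on {z} \<and> (\<exists>\<^sub>F w in at z. f w \<noteq> 0) \<and> zorder f z = n"

definition f1_zeta :: "int poly \<Rightarrow> real \<Rightarrow> complex" where
  "f1_zeta N s = Lim (at 1) (\<lambda>q. inv_Z N s q * (q - 1) powi (- poly N 1))"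

end

theory Submission
  imports Defs "HOL-Computational_Algebra.Field_as_Ring"
begin

text \<open>As formal series, \<open>Z(q, T) = \<Prod>\<^sub>i (1 - q\<^sup>i T)\<^bsup>-a\<^sub>i\<^esup>\<close>. For \<open>q \<noteq> 1\<close> near \<open>1\<close> the
  factors are pairwise coprime, so \<open>Z(q, q\<^bsup>-s\<^esup>)\<^bsup>-1\<^esup> = \<Prod>\<^sub>i (1 - q\<^bsup>i-s\<^esup>)\<^bsup>a\<^sub>i\<^esup>\<close>, and
  \<open>(1 - q\<^bsup>i-s\<^esup>) / (q - 1)\<close> tends to \<open>s - i\<close>.\<close>

section \<open>The exponential of a power series\<close>

text \<open>The product has derivative 0 and constant coefficient 1, which determines it. The same
  argument serves wherever an identity of exponentials is proved below.\<close>

lemma fps_exp_compose_minus: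
  fixes f :: "'a::field_char_0 fps"
  assumes "fps_nth f 0 = 0"
  shows "(fps_exp 1 oo f) * (fps_exp 1 oo (- f)) = 1"
proof -
  have "fps_deriv ((fps_exp 1 oo f) * (fps_exp 1 oo (- f))) = 0"
    using assms by (simp add: fps_compose_deriv algebra_simps)
  then show ?thesis
    using fps_deriv_eq_iff[of "(fps_exp 1 oo f) * (fps_exp 1 oo (- f))" 1] by simp
qed

text \<open>Multiplying the left side by the exponentials of \<open>- f\<close> and
  \<open>- g\<close> gives a series with derivative 0, hence 1; \<open>fps_exp_compose_minus\<close>
  then moves these two factors to the other side.\<close>

lemma fps_exp_compose_add:
  fixes f g :: "'a::field_char_0 fps"
  assumes "fps_nth f 0 = 0" "fps_nth g 0 = 0"
  shows "fps_exp 1 oo (f + g) = (fps_exp 1 oo f) * (fps_exp 1 oo g)"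
proof -
  let ?E = "\<lambda>h. fps_exp 1 oo (h :: 'a fps)"
  have "fps_deriv (?E (f + g) * (?E (- f) * ?E (- g))) = 0"
    using assms by (simp add: fps_compose_deriv algebra_simps)
  then have *: "?E (f + g) * (?E (- f) * ?E (- g)) = 1"
    using fps_deriv_eq_iff[of "?E (f + g) * (?E (- f) * ?E (- g))" 1] by simp
  have "?E (f + g) = ?E (f + g) * ((?E f * ?E (- f)) * (?E g * ?E (- g)))"
    using assms by (simp add: fps_exp_compose_minus)
  also have "\<dots> = (?E (f + g) * (?E (- f) * ?E (- g))) * (?E f * ?E g)"
    by (simp only: mult_ac)
  finally show ?thesis using * by simp
qed

lemma fps_exp_compose_of_nat_mult:
  fixes f :: "'a::field_char_0 fps"
  assumes "fps_nth f 0 = 0"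
  shows "fps_exp 1 oo (of_nat n * f) = (fps_exp 1 oo f) ^ n"
  using assms
  by (induction n) (simp_all add: fps_exp_compose_add distrib_right fps_compose_0_right)

lemma fps_exp_compose_sum:
  fixes f :: "'b \<Rightarrow> 'a::field_char_0 fps"
  assumes "\<And>i. i \<in> A \<Longrightarrow> fps_nth (f i) 0 = 0"
  shows "fps_exp 1 oo (\<Sum>i\<in>A. f i) = (\<Prod>i\<in>A. fps_exp 1 oo f i)"
  using assms
  by (induction A rule: infinite_finite_induct)
    (simp_all add: fps_exp_compose_add fps_sum_nth fps_compose_0_right)

text \<open>The formal series of -log(1 - c X).\<close>

definition fps_log_geometric :: "'a::field_char_0 \<Rightarrow> 'a fps" where
  "fps_log_geometric c = Abs_fps (\<lambda>r. if r = 0 then 0 else c ^ r / of_nat r)"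

lemma fps_log_geometric_nth_0 [simp]: "fps_nth (fps_log_geometric c) 0 = 0"
  by (simp add: fps_log_geometric_def)

text \<open>The derivative is the geometric series c / (1 - c X), stated with the denominator
  cleared.\<close>

lemma fps_deriv_log_geometric:
  "fps_deriv (fps_log_geometric c) * (1 - fps_const c * fps_X) = fps_const c"
proof (rule fps_ext)
  fix n
  have *: "fps_nth (fps_deriv (fps_log_geometric c)) n = c ^ Suc n" for n
    by (simp add: fps_log_geometric_def del: of_nat_Suc)
  have "fps_deriv (fps_log_geometric c) * (1 - fps_const c * fps_X) =
      fps_deriv (fps_log_geometric c) - fps_const c * (fps_deriv (fps_log_geometric c) * fps_X)"
    by (simp add: algebra_simps)
  then show "fps_nth (fps_deriv (fps_log_geometric c) * (1 - fps_const c * fps_X)) n =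
      fps_nth (fps_const c) n"
    by (cases n) (simp_all add: * del: fps_deriv_nth)
qed

lemma fps_exp_log_geometric:
  "(fps_exp 1 oo fps_log_geometric c) * (1 - fps_const c * fps_X) = (1 :: 'a::field_char_0 fps)"
proof -
  let ?E = "fps_exp 1 oo fps_log_geometric c"
  have "fps_deriv (?E * (1 - fps_const c * fps_X)) =
      ?E * (fps_deriv (fps_log_geometric c) * (1 - fps_const c * fps_X)) - ?E * fps_const c"
    by (simp add: fps_compose_deriv algebra_simps)
  also have "\<dots> = 0"
    by (simp add: fps_deriv_log_geometric)
  finally show ?thesis
    using fps_deriv_eq_iff[of "?E * (1 - fps_const c * fps_X)" 1] by simp
qed

text \<open>This is exp(-k log(1 - c X)) = (1 - c X)^(-k) with no inverse series: one of
  \<open>nat k\<close> and \<open>nat (- k)\<close> is 0, so both signs of \<open>k\<close> fit one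
  identity.\<close>

lemma fps_exp_of_int_log_geometric:
  fixes c :: "'a::field_char_0"
  shows "(fps_exp 1 oo (of_int k * fps_log_geometric c)) * (1 - fps_const c * fps_X) ^ nat k
    = (1 - fps_const c * fps_X) ^ nat (- k)"
proof (cases k rule: int_cases2)
  case (nonneg n)
  then show ?thesis
    by (simp add: fps_exp_compose_of_nat_mult fps_exp_log_geometric flip: power_mult_distrib)
next
  case (nonpos n)
  let ?L = "fps_log_geometric c"
  \<comment> \<open>Insert the n-th power of \<open>fps_exp_log_geometric\<close>, a factor 1, so
    that the two exponentials cancel.\<close>
  have "(fps_exp 1 oo (- (of_nat n * ?L))) =
      (fps_exp 1 oo (- (of_nat n * ?L))) * ((fps_exp 1 oo ?L) * (1 - fps_const c * fps_X)) ^ n"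
    by (simp add: fps_exp_log_geometric)
  also have "\<dots> = ((fps_exp 1 oo (of_nat n * ?L)) * (fps_exp 1 oo (- (of_nat n * ?L)))) *
      (1 - fps_const c * fps_X) ^ n"
    by (simp add: power_mult_distrib fps_exp_compose_of_nat_mult mult_ac)
  also have "\<dots> = (1 - fps_const c * fps_X) ^ n"
    by (subst fps_exp_compose_minus) simp_all
  finally show ?thesis using nonpos by simp
qed

section \<open>The zeta series as a rational function\<close>

lemma specialize_fps_mult:
  "specialize_fps (F * G) q = specialize_fps F q * specialize_fps G q"
  by (rule fps_ext) (simp add: specialize_fps_def fps_mult_nth poly_sum)

lemma specialize_fps_power: "specialize_fps (F ^ n) q = specialize_fps F q ^ n"
proof (induction n)
  case 0
  show ?case by (rule fps_ext) (simp add: specialize_fps_def)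
qed (simp add: specialize_fps_mult)

lemma specialize_fps_compose:
  "specialize_fps (F oo G) q = specialize_fps F q oo specialize_fps G q"
  \<comment> \<open>Specialisation is at first unfolded only for \<open>F\<close> and
    \<open>F oo G\<close>, so that the powers of \<open>G\<close> can be folded by
    \<open>specialize_fps_power\<close>.\<close>
  by (rule fps_ext) (simp add: fps_compose_nth poly_sum specialize_fps_def[of F]
      specialize_fps_def[of "F oo G"] flip: specialize_fps_power,
      simp add: specialize_fps_def)

lemma poly_of_int_sum_monom:
  fixes x :: "'a::comm_ring_1"
  shows "poly (map_poly of_int (\<Sum>i\<le>d. Polynomial.monom (a i) i)) x = (\<Sum>i\<le>d. of_int (a i) * x ^ i)"
proof -
  have "map_poly of_int (\<Sum>i\<le>d. Polynomial.monom (a i) i) =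
      (\<Sum>i\<le>d. Polynomial.monom (of_int (a i) :: 'a) i)"
    by (rule poly_eqI) (simp add: coeff_map_poly Polynomial.coeff_sum if_distrib[of of_int] cong: if_cong)
  then show ?thesis by (simp add: poly_sum poly_monom)
qed

text \<open>Since N(q^r) is the sum of a_i (q^i)^r, collecting the terms with fixed i yields a_i
  times -log(1 - q^i T).\<close>

lemma specialize_zeta_series:
  "specialize_fps (zeta_series (\<Sum>i\<le>d. Polynomial.monom (a i) i)) q =
     fps_exp 1 oo (\<Sum>i\<le>d. of_int (a i) * fps_log_geometric (q ^ i))"
proof -
  have 1: "specialize_fps (Abs_fps (\<lambda>k. [:1 / fact k:])) q = fps_exp (1 :: complex)"
    by (rule fps_ext) (simp add: specialize_fps_def)
  have 2: "specialize_fps (Abs_fps (\<lambda>r. if r = 0 then 0 else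
       Polynomial.smult (1 / of_nat r) (pcompose (map_poly of_int
         (\<Sum>i\<le>d. Polynomial.monom (a i) i)) (Polynomial.monom 1 r)))) q =
      (\<Sum>i\<le>d. of_int (a i) * fps_log_geometric (q ^ i))"
  proof (rule fps_ext, goal_cases)
    case (1 n)
    show ?case
      by (simp add: specialize_fps_def poly_pcompose poly_monom poly_of_int_sum_monom fps_sum_nth
          fps_log_geometric_def sum_divide_distrib mult.commute flip: fps_of_int power_mult)
  qed
  show ?thesis
    unfolding zeta_series_def specialize_fps_compose 1 2 ..
qed

text \<open>In this cross-multiplied form the product formula holds for every \<open>q\<close>, even
  where the two polynomials have common factors.\<close>

lemma specialize_zeta_series_mult:
  "specialize_fps (zeta_series (\<Sum>i\<le>d. Polynomial.monom (a i) i)) q *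
      fps_of_poly (\<Prod>i\<le>d. [:1, - (q ^ i):] ^ nat (a i)) =
    fps_of_poly (\<Prod>i\<le>d. [:1, - (q ^ i):] ^ nat (- a i))"
proof -
  have *: "fps_of_poly [:1, - (q ^ i):] = 1 - fps_const (q ^ i) * fps_X" for i
    by (simp add: fps_of_poly_linear' flip: fps_const_neg)
  have "specialize_fps (zeta_series (\<Sum>i\<le>d. Polynomial.monom (a i) i)) q =
      (\<Prod>i\<le>d. fps_exp 1 oo (of_int (a i) * fps_log_geometric (q ^ i)))"
    unfolding specialize_zeta_series by (rule fps_exp_compose_sum) simp
  then show ?thesis
    by (simp add: fps_of_poly_prod fps_of_poly_power * fps_exp_of_int_log_geometric
        flip: prod.distrib)
qed

section \<open>Values of the zeta series near q = 1\<close>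

text \<open>Makes the description in \<open>rational_value\<close> unique: two reduced fractions for
  \<open>F\<close> differ by a common factor \<open>k\<close>, which coprimality forces to be a
  nonzero constant. It cancels even where \<open>poly Q t = 0\<close>, both quotients being 0
  there.\<close>

lemma rational_value_eqI:
  assumes "coprime P Q" "Q \<noteq> 0" and PQ: "F * fps_of_poly Q = fps_of_poly P"
  shows "rational_value F t = poly P t / poly Q t"
  unfolding rational_value_def
proof (rule the_equality)
  show "\<exists>P' Q'. Q' \<noteq> 0 \<and> coprime P' Q' \<and> F * fps_of_poly Q' = fps_of_poly P' \<and>
      poly P t / poly Q t = poly P' t / poly Q' t"
    using assms by blast
next
  fix v
  assume "\<exists>P' Q'. Q' \<noteq> 0 \<and> coprime P' Q' \<and> F * fps_of_poly Q' = fps_of_poly P' \<and>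
      v = poly P' t / poly Q' t"
  then obtain P' Q' where *: "Q' \<noteq> 0" "coprime P' Q'" "F * fps_of_poly Q' = fps_of_poly P'"
    "v = poly P' t / poly Q' t"
    by blast
  have "fps_of_poly (P * Q') = fps_of_poly (P' * Q)"
    unfolding fps_of_poly_mult PQ[symmetric] *(3)[symmetric] by (simp only: mult_ac)
  then have eq: "P * Q' = P' * Q"
    by (simp add: fps_of_poly_eq_iff)
  have "Q dvd P * Q'" using eq by simp
  then have "Q dvd Q'"
    using assms(1) by (metis coprime_dvd_mult_right_iff coprime_commute)
  then obtain k where k: "Q' = Q * k" ..
  have P': "P' = P * k"
    using eq k assms(2) by (simp add: mult_ac)
  have "k dvd 1"
    using *(2) unfolding k P' by (meson coprime_def dvd_triv_right)
  then obtain c where "k = [:c:]" "c dvd 1"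
    by (rule is_unit_polyE)
  then show "v = poly P t / poly Q t"
    using *(4) unfolding k P' by auto
qed

text \<open>The combination y (1 - x T) - x (1 - y T) eliminates the variable and leaves the nonzero
  constant y - x.\<close>

lemma coprime_linear:
  fixes x y :: "'a::field_gcd"
  assumes "x \<noteq> y"
  shows "coprime [:1, - x:] [:1, - y:]"
proof (rule coprimeI)
  fix p assume "p dvd [:1, - x:]" "p dvd [:1, - y:]"
  then have "p dvd Polynomial.smult y [:1, - x:] - Polynomial.smult x [:1, - y:]"
    by (intro dvd_diff dvd_smult)
  also have "Polynomial.smult y [:1, - x:] - Polynomial.smult x [:1, - y:] = [:y - x:]"
    by simp
  finally show "is_unit p"
    using assms by (auto intro: dvd_trans simp: is_unit_const_poly_iff dvd_field_iff)
qed

lemma inv_Z_eq: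
  assumes "q \<noteq> 0" and inj: "inj_on (\<lambda>i. q ^ i) {..d}"
  shows "inv_Z (\<Sum>i\<le>d. Polynomial.monom (a i) i) s q =
    (\<Prod>i\<le>d. (1 - q powr (of_nat i - complex_of_real s)) powi a i)"
proof -
  let ?P = "\<Prod>i\<le>d. [:1, - (q ^ i):] ^ nat (- a i)"
  let ?Q = "\<Prod>i\<le>d. [:1, - (q ^ i):] ^ nat (a i)"
  let ?t = "q powr (- complex_of_real s)"
  have "coprime ([:1, - (q ^ i):] ^ nat (- a i)) ([:1, - (q ^ j):] ^ nat (a j))"
    if "i \<le> d" "j \<le> d" for i j
  \<comment> \<open>For equal indices one of the two exponents is 0; for different indices
    injectivity gives different linear factors.\<close>
  proof (cases "i = j")
    case True
    then show ?thesis by (cases "a i \<ge> 0") auto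
  next
    case False
    then have "q ^ i \<noteq> q ^ j" using inj that by (auto dest: inj_onD)
    then show ?thesis
      by (simp add: coprime_linear del: One_nat_def)
  qed
  then have cop: "coprime ?P ?Q"
    by (intro prod_coprime_left prod_coprime_right) auto
  have "?Q \<noteq> 0" by simp
  have t: "q ^ i * ?t = q powr (of_nat i - complex_of_real s)" for i
    using assms(1) by (simp add: powr_diff powr_minus divide_inverse powr_nat)
  \<comment> \<open>With division by 0 equal to 0, swapping numerator and denominator is valid at
    zeros and poles of Z as well.\<close>
  have "inv_Z (\<Sum>i\<le>d. Polynomial.monom (a i) i) s q = poly ?Q ?t / poly ?P ?t"
    unfolding inv_Z_def
    by (subst rational_value_eqI[OF cop \<open>?Q \<noteq> 0\<close> specialize_zeta_series_mult]) simp
  also have "\<dots> = (\<Prod>i\<le>d. (1 - q powr (of_nat i - complex_of_real s)) ^ nat (a i) /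
      (1 - q powr (of_nat i - complex_of_real s)) ^ nat (- a i))"
    unfolding poly_prod prod_dividef by (simp add: t mult.commute[of ?t])
  also have "\<dots> = (\<Prod>i\<le>d. (1 - q powr (of_nat i - complex_of_real s)) powi a i)"
    by (intro prod.cong refl) (simp add: power_int_def power_inverse divide_inverse)
  finally show ?thesis .
qed

text \<open>Only 0 and the roots of unity of order at most \<open>d\<close> must be avoided. They
  form a finite set; it may contain 1, but the filter is punctured there.\<close>

lemma eventually_inj_on_power_at_1:
  "eventually (\<lambda>q :: complex. q \<noteq> 0 \<and> inj_on (\<lambda>i. q ^ i) {..d}) (at 1)"
proof -
  have "finite (insert 0 (\<Union>k\<in>{1..d}. {q :: complex. q ^ k = 1}))"
    using finite_roots_unity by auto
  then have "eventually (\<lambda>q. q \<notin> insert 0 (\<Union>k\<in>{1..d}. {q :: complex. q ^ k = 1})) (at 1)"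
    by (metis islimpt_finite islimpt_iff_eventually)
  then show ?thesis
  proof eventually_elim
    case (elim q)
    then have q: "q \<noteq> 0" "\<And>k. 1 \<le> k \<Longrightarrow> k \<le> d \<Longrightarrow> q ^ k \<noteq> 1" by auto
    have "q ^ i \<noteq> q ^ j" if "i < j" "j \<le> d" for i j
    proof
      assume "q ^ i = q ^ j"
      moreover have "q ^ j = q ^ i * q ^ (j - i)"
        using that by (simp flip: power_add)
      ultimately show False using q that by simp
    qed
    then have "inj_on (\<lambda>i. q ^ i) {..d}"
      by (intro linorder_inj_onI) auto
    then show ?case using q by simp
  qed
qed

lemma eventually_inv_Z_eq:
  "eventually (\<lambda>q. inv_Z (\<Sum>i\<le>d. Polynomial.monom (a i) i) s q =
    (\<Prod>i\<le>d. (1 - q powr (of_nat i - complex_of_real s)) powi a i)) (at 1)"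
  using eventually_inj_on_power_at_1[of d] by eventually_elim (simp add: inv_Z_eq)

section \<open>Behaviour at \<open>q = 1\<close>\<close>

text \<open>This is the difference quotient at 1 of a function that vanishes there and has
  derivative \<open>- c\<close>.\<close>

lemma tendsto_one_minus_powr:
  "((\<lambda>q :: complex. (1 - q powr c) / (q - 1)) \<longlongrightarrow> - c) (at 1)"
proof -
  have "((\<lambda>q. 1 - q powr c) has_field_derivative - c) (at 1)"
    by (auto intro!: derivative_eq_intros)
  then show ?thesis by (simp add: has_field_derivative_iff)
qed

lemma eventually_one_minus_powr_nonzero:
  fixes c :: complex
  assumes "c \<noteq> 0"
  shows "eventually (\<lambda>q. 1 - q powr c \<noteq> 0) (at 1)"
  using tendsto_imp_eventually_ne[OF tendsto_one_minus_powr[of c], of 0] assms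
  by (auto elim: eventually_mono)

lemma analytic_one_minus_powr: "(\<lambda>q :: complex. 1 - q powr c) analytic_on {1}"
  by (auto intro!: analytic_intros)

lemma zorder_one_minus_powr:
  assumes "c \<noteq> 0"
  shows "zorder (\<lambda>q :: complex. 1 - q powr c) 1 = 1"
proof (rule zorder_zero_eqI')
  have "((\<lambda>q. 1 - q powr c) has_field_derivative - c) (at 1)"
    by (auto intro!: derivative_eq_intros)
  then show "(deriv ^^ nat 1) (\<lambda>q. 1 - q powr c) 1 \<noteq> 0"
    using assms by (simp add: DERIV_imp_deriv)
qed (auto simp: analytic_one_minus_powr)

text \<open>The case \<open>k = 0\<close> is the constant 1, so \<open>c = 0\<close> is allowed
  there: \<open>s\<close> may equal \<open>i\<close> when \<open>a i = 0\<close>.\<close>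

lemma zorder_one_minus_powr_powi:
  assumes "k \<noteq> 0 \<Longrightarrow> c \<noteq> 0"
  shows "zorder (\<lambda>q :: complex. (1 - q powr c) powi k) 1 = k"
proof (cases "k = 0")
  case False
  then have "frequently (\<lambda>q. 1 - q powr c \<noteq> 0) (at 1)"
    using assms eventually_one_minus_powr_nonzero eventually_frequently at_neq_bot by blast
  then show ?thesis
    using False assms
    by (simp add: zorder_power_int analytic_on_imp_meromorphic_on analytic_one_minus_powr
        zorder_one_minus_powr)
qed simp

text \<open>Each factor has order \<open>a i\<close>, and orders add. If \<open>s = real i\<close>
  with \<open>a i \<noteq> 0\<close>, the factor with exponent \<open>c = 0\<close> vanishes
  identically near 1 and there is no order; this is what the hypothesis excludes.\<close>

lemma inv_Z_has_zero_of_order: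
  assumes "\<And>i. i \<le> d \<Longrightarrow> a i \<noteq> 0 \<Longrightarrow> s \<noteq> real i"
  shows "has_zero_of_order (inv_Z (\<Sum>i\<le>d. Polynomial.monom (a i) i) s) 1 (\<Sum>i\<le>d. a i)"
proof -
  let ?f = "\<lambda>i q. (1 - q powr (of_nat i - complex_of_real s)) powi a i"
  have nz: "of_nat i - complex_of_real s \<noteq> 0" if "i \<le> d" "a i \<noteq> 0" for i
    using assms[OF that] by (metis eq_iff_diff_eq_0 of_real_eq_iff of_real_of_nat_eq)
  have mero: "?f i meromorphic_on {1}" for i
    by (intro meromorphic_on_powi analytic_on_imp_meromorphic_on analytic_one_minus_powr)
  have "eventually (\<lambda>q. ?f i q \<noteq> 0) (at 1)" if "i \<le> d" for i
  proof (cases "a i = 0")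
    case False
    then show ?thesis
      using eventually_one_minus_powr_nonzero[OF nz[OF that False]]
      by (auto elim: eventually_mono)
  qed simp
  then have "eventually (\<lambda>q. \<forall>i\<in>{..d}. ?f i q \<noteq> 0) (at 1)"
    by (intro eventually_ball_finite) auto
  then have ev: "eventually (\<lambda>q. (\<Prod>i\<le>d. ?f i q) \<noteq> 0) (at 1)"
    by (rule eventually_mono) auto
  have "zorder (\<lambda>q. \<Prod>i\<le>d. ?f i q) 1 = (\<Sum>i\<le>d. zorder (?f i) 1)"
    using mero ev by (rule zorder_prod)
  also have "\<dots> = (\<Sum>i\<le>d. a i)"
    using nz by (intro sum.cong refl zorder_one_minus_powr_powi) auto
  finally have "zorder (inv_Z (\<Sum>i\<le>d. Polynomial.monom (a i) i) s) 1 = (\<Sum>i\<le>d. a i)"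
    using zorder_cong[OF eventually_inv_Z_eq refl] by simp
  moreover have "inv_Z (\<Sum>i\<le>d. Polynomial.monom (a i) i) s meromorphic_on {1}"
    using mero by (subst meromorphic_on_cong[OF _ refl, where g = "\<lambda>q. \<Prod>i\<le>d. ?f i q"])
      (auto intro: meromorphic_on_prod eventually_inv_Z_eq)
  moreover have "eventually (\<lambda>q. inv_Z (\<Sum>i\<le>d. Polynomial.monom (a i) i) s q \<noteq> 0) (at 1)"
    using ev eventually_inv_Z_eq[of a d s] by eventually_elim simp
  then have "frequently (\<lambda>q. inv_Z (\<Sum>i\<le>d. Polynomial.monom (a i) i) s q \<noteq> 0) (at 1)"
    using eventually_frequently at_neq_bot by blast
  ultimately show ?thesis by (simp add: has_zero_of_order_def)
qed

section \<open>The normalised limit\<close>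

lemma power_int_sum:
  fixes x :: "'a::field"
  assumes "x \<noteq> 0"
  shows "x powi (\<Sum>i\<in>A. a i) = (\<Prod>i\<in>A. x powi a i)"
  using assms by (induction A rule: infinite_finite_induct) (simp_all add: power_int_add)

text \<open>The power of \<open>q - 1\<close> is distributed over the factors, giving one difference
  quotient per index. Only negative exponents need a nonzero limit, so \<open>s = real i\<close> is
  permitted when \<open>a i \<ge> 0\<close>.\<close>

lemma tendsto_inv_Z:
  assumes "\<And>i. i \<le> d \<Longrightarrow> a i < 0 \<Longrightarrow> s \<noteq> real i"
  shows "((\<lambda>q. inv_Z (\<Sum>i\<le>d. Polynomial.monom (a i) i) s q * (q - 1) powi (- (\<Sum>i\<le>d. a i)))
    \<longlongrightarrow> (\<Prod>i\<le>d. (complex_of_real s - of_nat i) powi a i)) (at 1)"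
proof -
  have "((\<lambda>q. \<Prod>i\<le>d. ((1 - q powr (of_nat i - complex_of_real s)) / (q - 1)) powi a i)
    \<longlongrightarrow> (\<Prod>i\<le>d. (- (of_nat i - complex_of_real s)) powi a i)) (at 1)"
  proof (intro tendsto_prod tendsto_power_int' tendsto_one_minus_powr)
    fix i assume "i \<in> {..d}"
    then show "- (of_nat i - complex_of_real s) \<noteq> 0 \<or> 0 \<le> a i"
      using assms[of i] by (metis atMost_iff eq_iff_diff_eq_0 linorder_not_le neg_equal_0_iff_equal
          of_real_eq_iff of_real_of_nat_eq)
  qed
  then have lim: "((\<lambda>q. \<Prod>i\<le>d. ((1 - q powr (of_nat i - complex_of_real s)) / (q - 1)) powi a i)
    \<longlongrightarrow> (\<Prod>i\<le>d. (complex_of_real s - of_nat i) powi a i)) (at 1)"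
    by simp
  have "eventually (\<lambda>q :: complex. q \<noteq> 1) (at 1)"
    by (simp add: eventually_at_filter)
  with eventually_inv_Z_eq[of a d s]
  have "eventually (\<lambda>q. (\<Prod>i\<le>d. ((1 - q powr (of_nat i - complex_of_real s)) / (q - 1)) powi a i) =
    inv_Z (\<Sum>i\<le>d. Polynomial.monom (a i) i) s q * (q - 1) powi (- (\<Sum>i\<le>d. a i))) (at 1)"
  proof eventually_elim
    case (elim q)
    then have "q - 1 \<noteq> 0" by simp
    then show ?case
      unfolding elim(1) power_int_divide_distrib prod_dividef power_int_minus
        power_int_sum[OF \<open>q - 1 \<noteq> 0\<close>] by (simp only: divide_inverse)
  qed
  then show ?thesis using lim by (rule Lim_transform_eventually[rotated])
qed

lemma f1_zeta_eq:
  assumes "\<And>i. i \<le> d \<Longrightarrow> a i < 0 \<Longrightarrow> s \<noteq> real i"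
    and "N = (\<Sum>i\<le>d. Polynomial.monom (a i) i)"
  shows "f1_zeta N s = (\<Prod>i\<le>d. (complex_of_real s - of_nat i) powi a i)"
proof -
  have "poly N 1 = (\<Sum>i\<le>d. a i)"
    by (simp add: assms(2) poly_sum poly_monom)
  then show ?thesis
    unfolding f1_zeta_def assms(2) using tendsto_inv_Z[OF assms(1)]
    by (intro tendsto_Lim) auto
qed

section \<open>Zeta as a quotient of integer polynomials\<close>

lemma map_poly_of_int_mult:
  "map_poly of_int (p * q) = (map_poly of_int p * map_poly of_int q :: 'a::comm_ring_1 poly)"
  by (rule poly_eqI) (simp add: coeff_map_poly Polynomial.coeff_mult)

lemma poly_of_int_prod_linear:
  fixes x :: "'a::comm_ring_1"
  shows "poly (map_poly of_int (\<Prod>i\<in>A. [:- int i, 1:] ^ k i)) x = (\<Prod>i\<in>A. (x - of_nat i) ^ k i)"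
proof (induction A rule: infinite_finite_induct)
  case (insert i A)
  have "poly (map_poly of_int ([:- int i, 1:] ^ n)) x = (x - of_nat i) ^ n" for n
  proof (induction n)
    case (Suc n)
    then show ?case
      unfolding power_Suc map_poly_of_int_mult poly_mult by (simp add: map_poly_pCons)
  qed simp
  with insert show ?case by (simp add: map_poly_of_int_mult)
qed auto

theorem lemma1:
  fixes X :: "('u::infinite, 'x, 'b) f1_object" and N :: "int poly"
  assumes "f1_variety X"
    and "point_count_polynomial X N"
  shows "(\<forall>s::real. (\<forall>i. Polynomial.coeff N i \<noteq> 0 \<longrightarrow> s \<noteq> real i) \<longrightarrow>
            has_zero_of_order (inv_Z N s) 1 (poly N 1))
    \<and> (\<forall>s::real. (\<forall>i. Polynomial.coeff N i < 0 \<longrightarrow> s \<noteq> real i) \<longrightarrow>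
            ((\<lambda>q. inv_Z N s q * (q - 1) powi (- poly N 1)) \<longlongrightarrow> f1_zeta N s) (at 1))
    \<and> (\<exists>P Q :: int poly. Q \<noteq> 0 \<and>
          (\<forall>s::real. (\<forall>i. Polynomial.coeff N i < 0 \<longrightarrow> s \<noteq> real i) \<longrightarrow>
             poly (map_poly of_int Q) (complex_of_real s) \<noteq> 0 \<and>
             f1_zeta N s = poly (map_poly of_int P) (complex_of_real s)
                             / poly (map_poly of_int Q) (complex_of_real s)))
    \<and> ((\<forall>i. Polynomial.coeff N i \<ge> 0) \<longrightarrow>
          (\<exists>P :: int poly. \<forall>s::real. f1_zeta N s = poly (map_poly of_int P) (complex_of_real s)))
    \<and> (\<forall>(d::nat) (a :: nat \<Rightarrow> int). N = (\<Sum>i\<le>d. Polynomial.monom (a i) i) \<longrightarrow>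
          (\<forall>s::real. (\<forall>i\<le>d. a i < 0 \<longrightarrow> s \<noteq> real i) \<longrightarrow>
             f1_zeta N s = (\<Prod>i\<le>d. (complex_of_real s - of_nat i) powi (a i))))"
proof -
  define d where "d = Polynomial.degree N"
  define a where "a = Polynomial.coeff N"
  have N: "N = (\<Sum>i\<le>d. Polynomial.monom (a i) i)"
    by (simp add: d_def a_def poly_as_sum_of_monoms)
  have N1: "poly N 1 = (\<Sum>i\<le>d. a i)"
    by (subst N) (simp add: poly_sum poly_monom)
  have zero: "has_zero_of_order (inv_Z N s) 1 (poly N 1)"
    if "\<forall>i. a i \<noteq> 0 \<longrightarrow> s \<noteq> real i" for s
    unfolding N1 by (subst N, rule inv_Z_has_zero_of_order) (use that in auto)
  have zeta: "f1_zeta N s = (\<Prod>i\<le>d. (complex_of_real s - of_nat i) powi a i)"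
    if "\<forall>i. a i < 0 \<longrightarrow> s \<noteq> real i" for s
    by (rule f1_zeta_eq[OF _ N]) (use that in auto)
  have lim: "((\<lambda>q. inv_Z N s q * (q - 1) powi (- poly N 1)) \<longlongrightarrow> f1_zeta N s) (at 1)"
    if "\<forall>i. a i < 0 \<longrightarrow> s \<noteq> real i" for s
    unfolding zeta[OF that] N1 by (subst N, rule tendsto_inv_Z) (use that in auto)
  \<comment> \<open>The product of the (s - i)^(a_i) is split by the sign of a_i: \<open>P\<close>
    takes the positive exponents, \<open>Q\<close> the negative ones.\<close>
  define P where "P = (\<Prod>i\<le>d. [:- int i, 1:] ^ nat (a i))"
  define Q where "Q = (\<Prod>i\<le>d. [:- int i, 1:] ^ nat (- a i))"
  have "Q \<noteq> 0" by (simp add: Q_def)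
  have Qnz: "poly (map_poly of_int Q) (complex_of_real s) \<noteq> 0"
    if "\<forall>i. a i < 0 \<longrightarrow> s \<noteq> real i" for s
  proof -
    have "complex_of_real s - of_nat i \<noteq> 0" if "a i < 0" for i
      using \<open>\<forall>i. a i < 0 \<longrightarrow> s \<noteq> real i\<close> that
      by (metis eq_iff_diff_eq_0 of_real_eq_iff of_real_of_nat_eq)
    then show ?thesis
      unfolding Q_def poly_of_int_prod_linear by fastforce
  qed
  have PQ: "f1_zeta N s = poly (map_poly of_int P) (complex_of_real s) /
      poly (map_poly of_int Q) (complex_of_real s)"
    if "\<forall>i. a i < 0 \<longrightarrow> s \<noteq> real i" for s
    unfolding zeta[OF that] P_def Q_def poly_of_int_prod_linear prod_dividef[symmetric]
    by (intro prod.cong refl) (auto simp: power_int_def power_inverse divide_inverse)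
  have pol: "\<exists>P :: int poly. \<forall>s::real. f1_zeta N s = poly (map_poly of_int P) (complex_of_real s)"
    if "\<forall>i. a i \<ge> 0"
  proof -
    \<comment> \<open>Without negative coefficients the denominator is trivial and the condition on
      \<open>s\<close> in \<open>PQ\<close> is vacuous.\<close>
    have "Q = 1" using that by (simp add: Q_def)
    then show ?thesis
      using PQ that by (intro exI[of _ P]) (simp add: not_less[symmetric])
  qed
  have prod: "f1_zeta N s = (\<Prod>i\<le>e. (complex_of_real s - of_nat i) powi (b i))"
    if "N = (\<Sum>i\<le>e. Polynomial.monom (b i) i)" "\<forall>i\<le>e. b i < 0 \<longrightarrow> s \<noteq> real i" for e b s
    by (rule f1_zeta_eq[OF _ that(1)]) (use that(2) in auto)
  show ?thesis
    unfolding a_def[symmetric]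
  proof (intro conjI allI impI)
    show "\<exists>P Q :: int poly. Q \<noteq> 0 \<and>
        (\<forall>s::real. (\<forall>i. a i < 0 \<longrightarrow> s \<noteq> real i) \<longrightarrow>
           poly (map_poly of_int Q) (complex_of_real s) \<noteq> 0 \<and>
           f1_zeta N s = poly (map_poly of_int P) (complex_of_real s)
                           / poly (map_poly of_int Q) (complex_of_real s))"
      using \<open>Q \<noteq> 0\<close> Qnz PQ by (intro exI[of _ P] exI[of _ Q]) blast
  qed (rule zero lim pol prod; assumption)+
qed

end
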